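(* a) $(\widehat{\mathbb{R}}/{\approx},\sqsubset,\boxplus,\boxdot,m_{\approx}(0),m_{\approx}(1))$ is an ordered field with $m_{\approx}(0)$ and $m_{\approx}(1)$ as zero and identity elements, respectively. b) The mapping $\phi:\widehat{\mathbb{R}}/{\approx}\to\mathbb{R}$, defined by $\phi(m_{\approx}(x)):=\sigma x$, is an ordered field isomorphism of $(\widehat{\mathbb{R}}/{\approx},\sqsubset,\boxplus,\boxdot,m_{\approx}(0),m_{\approx}(1))$ onto the usual ordered field $(\mathbb{R},<,+,\cdot,0,1)$; so $\widehat{\mathbb{R}}/{\approx}$ is isomorphic to $\mathbb{R}$.
   Context: $\widehat{\mathbb{R}}$ is the set of all convergent sequences of real numbers; a real number is identified with the corresponding constant sequence. The shadow $\sigma x\in\mathbb{R}$ is the limit of $x$. For $x=(\xi_n),y=(\eta_n)\in\widehat{\mathbb{R}}$: $x+y:=(\xi_n+\eta_n)$, $xy:=(\sigma x\,\eta_n+\sigma y\,\xi_n-\sigma x\,\sigma y)$, and $x<y$ iff $\sigma x<\sigma y$. Indiscernibility is the equivalence relation $x\approx y$ iff $\sigma x=\sigma y$; the equivalence class of $x$ is the monad $m_{\approx}(x)$, and $\widehat{\mathbb{R}}/{\approx}:=\{m_{\approx}(x)\mid x\in\widehat{\mathbb{R}}\}$. On this quotient the following are well-defined: $m_{\approx}(x)\boxplus m_{\approx}(y):=m_{\approx}(x+y)$, $m_{\approx}(x)\boxdot m_{\approx}(y):=m_{\approx}(xy)$, and $m_{\approx}(x)\sqsubset m_{\approx}(y)$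 iff $x<y$. *)

theory Defs
  imports Complex_Main "HOL-Algebra.QuotRing"
begin

section \<open>Ordered fields with explicit carrier\<close>

record 'a lt_ring = "'a ring" +
  lt :: "'a \<Rightarrow> 'a \<Rightarrow> bool"  (infixl \<open>\<prec>\<index>\<close> 50)

text \<open>The relation is cut down to the carrier because \<^const>\<open>strict_linear_order_on\<close>
  demands transitivity and irreflexivity on the whole type.\<close>

locale ordered_field = field R for R (structure) +
  assumes lt_strict_linear_order:
      "strict_linear_order_on (carrier R) {(x, y). x \<in> carrier R \<and> y \<in> carrier R \<and> x \<prec> y}"
    and lt_add:
      "\<lbrakk>x \<prec> y; x \<in> carrier R; y \<in> carrier R; z \<in> carrier R\<rbrakk> \<Longrightarrow> x \<oplus> z \<prec> y \<oplus> z"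
    and lt_mult:
      "\<lbrakk>\<zero> \<prec> x; \<zero> \<prec> y; x \<in> carrier R; y \<in> carrier R\<rbrakk> \<Longrightarrow> \<zero> \<prec> x \<otimes> y"

definition ordered_field_iso ::
    "('a, 'm) lt_ring_scheme \<Rightarrow> ('b, 'n) lt_ring_scheme \<Rightarrow> ('a \<Rightarrow> 'b) set"
  where "ordered_field_iso R S =
    {h \<in> ring_iso R S. \<forall>x\<in>carrier R. \<forall>y\<in>carrier R. x \<prec>\<^bsub>R\<^esub> y \<longleftrightarrow> h x \<prec>\<^bsub>S\<^esub> h y}"

definition ordered_field_isomorphic ::
    "('a, 'm) lt_ring_scheme \<Rightarrow> ('b, 'n) lt_ring_scheme \<Rightarrow> bool"
  where "ordered_field_isomorphic R S \<longleftrightarrow> ordered_field_iso R S \<noteq> {}"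

definition real_field :: "real lt_ring"
  where "real_field =
    \<lparr>carrier = UNIV, mult = (*), one = 1, zero = 0, add = (+), lt = (<)\<rparr>"


section \<open>Convergent sequences\<close>

definition hat_R :: "(nat \<Rightarrow> real) set"
  where "hat_R = {x. convergent x}"

definition const_seq :: "real \<Rightarrow> nat \<Rightarrow> real"
  where "const_seq r = (\<lambda>n. r)"

definition shadow :: "(nat \<Rightarrow> real) \<Rightarrow> real"
  where "shadow x = lim x"

definition hat_add :: "(nat \<Rightarrow> real) \<Rightarrow> (nat \<Rightarrow> real) \<Rightarrow> nat \<Rightarrow> real"
  where "hat_add x y = (\<lambda>n. x n + y n)"

definition hat_mult :: "(nat \<Rightarrow> real) \<Rightarrow> (nat \<Rightarrow> real) \<Rightarrow> nat \<Rightarrow> real"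
  where "hat_mult x y = (\<lambda>n. shadow x * y n + shadow y * x n - shadow x * shadow y)"

text \<open>Not the pointwise order \<^term>\<open>x < y\<close> on functions.\<close>

definition hat_less :: "(nat \<Rightarrow> real) \<Rightarrow> (nat \<Rightarrow> real) \<Rightarrow> bool"
  where "hat_less x y \<longleftrightarrow> shadow x < shadow y"

definition indisc :: "((nat \<Rightarrow> real) \<times> (nat \<Rightarrow> real)) set"
  where "indisc = {(x, y). x \<in> hat_R \<and> y \<in> hat_R \<and> shadow x = shadow y}"

definition monad :: "(nat \<Rightarrow> real) \<Rightarrow> (nat \<Rightarrow> real) set"
  where "monad x = indisc `` {x}"


section \<open>The quotient by indiscernibility\<close>

text \<open>The operations on monads are given by the usual union over representatives. The lemmas
  \<open>monad_add_monad\<close>, \<open>monad_mult_monad\<close>, \<open>monad_less_monad\<close> and \<open>phi_monad\<close> below show that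
  they do not depend on the representatives, and so satisfy the intended defining equations.\<close>

definition monad_add :: "(nat \<Rightarrow> real) set \<Rightarrow> (nat \<Rightarrow> real) set \<Rightarrow> (nat \<Rightarrow> real) set"
  where "monad_add A B = (\<Union>x\<in>A. \<Union>y\<in>B. monad (hat_add x y))"

definition monad_mult :: "(nat \<Rightarrow> real) set \<Rightarrow> (nat \<Rightarrow> real) set \<Rightarrow> (nat \<Rightarrow> real) set"
  where "monad_mult A B = (\<Union>x\<in>A. \<Union>y\<in>B. monad (hat_mult x y))"

definition monad_less :: "(nat \<Rightarrow> real) set \<Rightarrow> (nat \<Rightarrow> real) set \<Rightarrow> bool"
  where "monad_less A B \<longleftrightarrow> (\<exists>x\<in>A. \<exists>y\<in>B. hat_less x y)"

definition hat_R_quot :: "(nat \<Rightarrow> real) set lt_ring"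
  where "hat_R_quot =
    \<lparr>carrier = hat_R // indisc, mult = monad_mult, one = monad (const_seq 1),
     zero = monad (const_seq 0), add = monad_add, lt = monad_less\<rparr>"

definition phi :: "(nat \<Rightarrow> real) set \<Rightarrow> real"
  where "phi A = the_elem (shadow ` A)"

lemma equiv_indisc: "equiv hat_R indisc"
  by (rule equivI) (auto simp: indisc_def refl_on_def sym_def trans_def)

lemma carrier_hat_R_quot: "carrier hat_R_quot = monad ` hat_R"
  by (auto simp: hat_R_quot_def quotient_def monad_def)

lemma mem_monad_iff: "x \<in> hat_R \<Longrightarrow> y \<in> monad x \<longleftrightarrow> y \<in> hat_R \<and> shadow y = shadow x"
  by (auto simp: monad_def indisc_def)

lemma monad_eq_iff: "x \<in> hat_R \<Longrightarrow> y \<in> hat_R \<Longrightarrow> monad x = monad y \<longleftrightarrow> shadow x = shadow y"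
  by (metis (no_types, lifting) mem_monad_iff subsetI subset_antisym)

lemma hat_R_iff_shadow: "x \<in> hat_R \<longleftrightarrow> x \<longlonglongrightarrow> shadow x"
  by (simp add: hat_R_def shadow_def convergent_LIMSEQ_iff)

lemma hat_RI:
  assumes "x \<longlonglongrightarrow> r"
  shows "x \<in> hat_R" "shadow x = r"
  using assms by (auto simp: hat_R_def shadow_def convergent_def limI)

lemma const_seq_hat_R: "const_seq r \<in> hat_R" "shadow (const_seq r) = r"
  using hat_RI[of "const_seq r" r] by (simp_all add: const_seq_def)

lemma hat_add_hat_R:
  assumes "x \<in> hat_R" "y \<in> hat_R"
  shows "hat_add x y \<in> hat_R" "shadow (hat_add x y) = shadow x + shadow y"
proof -
  have "hat_add x y \<longlonglongrightarrow> shadow x + shadow y"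
    using assms unfolding hat_add_def hat_R_iff_shadow by (intro tendsto_add)
  then show "hat_add x y \<in> hat_R" "shadow (hat_add x y) = shadow x + shadow y"
    by (rule hat_RI)+
qed

lemma hat_mult_hat_R:
  assumes "x \<in> hat_R" "y \<in> hat_R"
  shows "hat_mult x y \<in> hat_R" "shadow (hat_mult x y) = shadow x * shadow y"
proof -
  have "hat_mult x y \<longlonglongrightarrow>
      shadow x * shadow y + shadow y * shadow x - shadow x * shadow y"
    using assms unfolding hat_mult_def hat_R_iff_shadow by (intro tendsto_intros)
  then have "hat_mult x y \<longlonglongrightarrow> shadow x * shadow y"
    by (simp add: mult.commute)
  then show "hat_mult x y \<in> hat_R" "shadow (hat_mult x y) = shadow x * shadow y"
    by (rule hat_RI)+
qed

lemma monad_add_monad: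
  assumes "x \<in> hat_R" "y \<in> hat_R"
  shows "monad_add (monad x) (monad y) = monad (hat_add x y)"
proof -
  have "monad (hat_add x' y') = monad (hat_add x y)" if "x' \<in> monad x" "y' \<in> monad y" for x' y'
    using that assms by (auto simp: mem_monad_iff monad_eq_iff hat_add_hat_R)
  moreover have "x \<in> monad x" "y \<in> monad y"
    using assms by (auto simp: mem_monad_iff)
  ultimately show ?thesis
    unfolding monad_add_def by blast
qed

lemma monad_mult_monad:
  assumes "x \<in> hat_R" "y \<in> hat_R"
  shows "monad_mult (monad x) (monad y) = monad (hat_mult x y)"
proof -
  have "monad (hat_mult x' y') = monad (hat_mult x y)" if "x' \<in> monad x" "y' \<in> monad y" for x' y'
    using that assms by (auto simp: mem_monad_iff monad_eq_iff hat_mult_hat_R)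
  moreover have "x \<in> monad x" "y \<in> monad y"
    using assms by (auto simp: mem_monad_iff)
  ultimately show ?thesis
    unfolding monad_mult_def by blast
qed

lemma monad_less_monad:
  assumes "x \<in> hat_R" "y \<in> hat_R"
  shows "monad_less (monad x) (monad y) \<longleftrightarrow> hat_less x y"
  using assms by (auto simp: monad_less_def hat_less_def mem_monad_iff)

lemma phi_monad:
  assumes "x \<in> hat_R"
  shows "phi (monad x) = shadow x"
proof -
  have "shadow ` monad x = {shadow x}"
    using assms by (auto simp: mem_monad_iff)
  then show ?thesis
    by (simp add: phi_def)
qed

end

theory Submission
  imports Defs
begin

text \<open>Every monad contains exactly one constant sequence, so \<open>r \<mapsto> monad (const_seq r)\<close> is a
  bijection from the reals onto the quotient which carries addition, multiplication and order
  over; the ordered field axioms are inherited from the reals, and \<open>phi\<close> is its inverse.\<close>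

text \<open>Both sequences have the same shadow, and the shadow determines the monad. This makes
  \<open>r \<mapsto> monad (const_seq r)\<close> surjective onto the quotient.\<close>

lemma monad_eq_monad_const_shadow: "x \<in> hat_R \<Longrightarrow> monad x = monad (const_seq (shadow x))"
  by (simp add: monad_eq_iff const_seq_hat_R)

lemma carrier_hat_R_quot_const: "carrier hat_R_quot = range (\<lambda>r. monad (const_seq r))"
  unfolding carrier_hat_R_quot using monad_eq_monad_const_shadow const_seq_hat_R(1) by blast

lemma monad_const_eq_iff: "monad (const_seq r) = monad (const_seq s) \<longleftrightarrow> r = s"
  by (simp add: monad_eq_iff const_seq_hat_R)

lemma phi_monad_const: "phi (monad (const_seq r)) = r"
  by (simp add: phi_monad const_seq_hat_R)

text \<open>Monads are compared through shadows, and the shadow is additive on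
  \<open>hat_add\<close>; its multiplicativity on \<open>hat_mult\<close> gives the analogue for
  products.\<close>

lemma add_monad_const:
  "monad (const_seq r) \<oplus>\<^bsub>hat_R_quot\<^esub> monad (const_seq s) = monad (const_seq (r + s))"
  by (simp add: hat_R_quot_def monad_add_monad monad_eq_iff hat_add_hat_R const_seq_hat_R)

lemma mult_monad_const:
  "monad (const_seq r) \<otimes>\<^bsub>hat_R_quot\<^esub> monad (const_seq s) = monad (const_seq (r * s))"
  by (simp add: hat_R_quot_def monad_mult_monad monad_eq_iff hat_mult_hat_R const_seq_hat_R)

lemma lt_monad_const: "monad (const_seq r) \<prec>\<^bsub>hat_R_quot\<^esub> monad (const_seq s) \<longleftrightarrow> r < s"
  by (simp add: hat_R_quot_def monad_less_monad hat_less_def const_seq_hat_R)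

lemma zero_hat_R_quot: "\<zero>\<^bsub>hat_R_quot\<^esub> = monad (const_seq 0)"
  by (simp add: hat_R_quot_def)

lemma one_hat_R_quot: "\<one>\<^bsub>hat_R_quot\<^esub> = monad (const_seq 1)"
  by (simp add: hat_R_quot_def)

text \<open>Rewriting with these turns quantifiers over the carrier into quantifiers over real
  numbers, so each axiom becomes a fact about the reals.\<close>

lemmas hat_R_quot_simps = carrier_hat_R_quot_const monad_const_eq_iff add_monad_const
  mult_monad_const lt_monad_const zero_hat_R_quot one_hat_R_quot

lemma cring_hat_R_quot: "cring hat_R_quot"
proof (rule cringI)
  show "abelian_group hat_R_quot"
  proof (rule abelian_groupI)
    show "\<exists>y\<in>carrier hat_R_quot. y \<oplus>\<^bsub>hat_R_quot\<^esub> x = \<zero>\<^bsub>hat_R_quot\<^esub>"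
      if "x \<in> carrier hat_R_quot" for x
    proof -
      from that obtain r where "x = monad (const_seq r)"
        by (auto simp: hat_R_quot_simps)
      then show ?thesis
        by (auto simp: hat_R_quot_simps intro: exI[of _ "- r"])
    qed
  qed (auto simp: hat_R_quot_simps algebra_simps)
  show "comm_monoid hat_R_quot"
    by (rule comm_monoidI) (auto simp: hat_R_quot_simps algebra_simps)
qed (auto simp: hat_R_quot_simps algebra_simps)

lemma field_hat_R_quot: "field hat_R_quot"
proof (rule cring.cring_fieldI2[OF cring_hat_R_quot])
  show "\<zero>\<^bsub>hat_R_quot\<^esub> \<noteq> \<one>\<^bsub>hat_R_quot\<^esub>"
    by (simp add: hat_R_quot_simps)
  show "\<exists>b\<in>carrier hat_R_quot. a \<otimes>\<^bsub>hat_R_quot\<^esub> b = \<one>\<^bsub>hat_R_quot\<^esub>"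
    if "a \<in> carrier hat_R_quot" "a \<noteq> \<zero>\<^bsub>hat_R_quot\<^esub>" for a
  proof -
    \<comment> \<open>Injectivity of \<open>r \<mapsto> monad (const_seq r)\<close> gives
      \<open>r \<noteq> 0\<close>, so \<open>inverse r\<close> is a true inverse and not the default
      value \<open>inverse 0 = 0\<close>.\<close>
    from that obtain r where "a = monad (const_seq r)" "r \<noteq> 0"
      by (auto simp: hat_R_quot_simps)
    then show ?thesis
      by (auto simp: hat_R_quot_simps intro: exI[of _ "inverse r"])
  qed
qed

lemma ordered_field_hat_R_quot: "ordered_field hat_R_quot"
proof (intro ordered_field.intro ordered_field_axioms.intro field_hat_R_quot)
  show "strict_linear_order_on (carrier hat_R_quot)
    {(x, y). x \<in> carrier hat_R_quot \<and> y \<in> carrier hat_R_quot \<and> x \<prec>\<^bsub>hat_R_quot\<^esub> y}"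
    \<comment> \<open>Transitivity and irreflexivity range over the whole type, but only pairs from
      the carrier lie in the relation, so both reduce to \<open><\<close> on the reals.\<close>
    unfolding strict_linear_order_on_def trans_def irrefl_def total_on_def
    by (auto simp: hat_R_quot_simps)
qed (auto simp: hat_R_quot_simps)

lemma phi_ordered_field_iso: "phi \<in> ordered_field_iso hat_R_quot real_field"
proof -
  have "bij_betw phi (carrier hat_R_quot) UNIV"
    by (rule bij_betw_byWitness[where f' = "\<lambda>r. monad (const_seq r)"])
      (auto simp: hat_R_quot_simps phi_monad_const)
  moreover have "phi \<in> ring_hom hat_R_quot real_field"
    by (rule ring_hom_memI) (auto simp: hat_R_quot_simps phi_monad_const real_field_def)
  \<comment> \<open>Only the order clause remains: on classes of constant sequences both sides
    reduce to \<open>r < s\<close>.\<close>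
  ultimately show ?thesis
    by (auto simp: ordered_field_iso_def ring_iso_def hat_R_quot_simps phi_monad_const
        real_field_def)
qed

theorem theorem3p8:
  shows "ordered_field hat_R_quot \<and>
    (\<forall>x\<in>hat_R. phi (monad x) = shadow x) \<and>
    phi \<in> ordered_field_iso hat_R_quot real_field \<and>
    ordered_field_isomorphic hat_R_quot real_field"
  using ordered_field_hat_R_quot phi_monad phi_ordered_field_iso
  by (auto simp: ordered_field_isomorphic_def)

end
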